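(* Let $(\mathbb{A},\Gamma)$ and $(\mathbb{B},\Lambda)$ be hyperbolic iterated function systems with attractors $\mathbb{A}$ and $\mathbb{B}$, respectively (that is, the whole space is the attractor in each case). Suppose $f\colon\mathbb{A}\to\mathbb{B}$ and $\alpha\colon\Gamma\to\Lambda$ are functions. Then $(f,\alpha)$ is a morphism from $(\mathbb{A},\Gamma)$ to $(\mathbb{B},\Lambda)$ if and only if the graph $\mathrm{Gr}(f)=\{(x,f(x))\mid x\in\mathbb{A}\}$ is the attractor of the fibred system $(\mathbb{A}\times\mathbb{B},\Gamma\times_\alpha\Lambda)$.
   Context: A (hyperbolic) iterated function system $(X,\Gamma)$ consists of a nonempty complete metric space $(X,d)$ together with a nonempty finite collection $\Gamma$ of proper contractions on $X$: for each $\gamma\in\Gamma$, $\gamma\colon X\to X$ and there is $0\le c_\gamma<1$ with $d(\gamma(x),\gamma(y))\le c_\gamma d(x,y)$ for all $x,y\in X$. Distinct members of the collection $\Gamma$ are allowed to be equal as maps (distinct copies of the same map), i.e. $\Gamma$ may be regarded as an indexed family. Let $\mathcal{K}(X)$ be the set of nonempty compact subsets of $X$. The Hutchinson operator $\Gamma\colon\mathcal{K}(X)\to\mathcal{K}(X)$ is $\Gamma(K)=\bigcup_{\gamma\in\Gamma}\gamma(K)$. The attractor of $(X,\Gamma)$ is its unique fixed point in $\mathcal{K}(X)$ (it exists and is unique by Hutchinson's Theorem). A morphism $(f,\alpha)\colon(X,\Gamma)\to(Y,\Lambda)$ is a pair consisting of a continuous map $f\colon X\to Y$ and a function $\alpha\colon\Gamma\to\Lambda$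 such that $f\circ\gamma=\alpha(\gamma)\circ f$ for every $\gamma\in\Gamma$. For iterated function systems $(X,\Gamma)$, $(Y,\Lambda)$, a function $\alpha\colon\Gamma\to\Lambda$ and $\gamma\in\Gamma$ define $\gamma^\alpha\colon X\times Y\to X\times Y$ by $\gamma^\alpha(x,y)=(\gamma(x),\alpha(\gamma)(y))$, and let $\Gamma\times_\alpha\Lambda:=\{\gamma^\alpha\mid\gamma\in\Gamma\}$. With $X\times Y$ equipped with the metric $d_\infty((x_1,y_1),(x_2,y_2))=\max\{d_X(x_1,x_2),d_Y(y_1,y_2)\}$, the pair $(X\times Y,\Gamma\times_\alpha\Lambda)$ is a hyperbolic iterated function system, called the system fibred over $\alpha$. *)

theory Defs
  imports "HOL-Analysis.Analysis"
begin

text \<open>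
  A hyperbolic iterated function system is given by a metric space with carrier \<open>X\<close> and
  distance \<open>d\<close> together with a family \<open>\<gamma>\<close> of maps indexed by a finite nonempty set \<open>I\<close>.
  Different indices may carry the same map; this accounts for distinct copies of a map.
  Only the values of \<open>\<gamma> i\<close> on \<open>X\<close>, for \<open>i \<in> I\<close>, are relevant.
\<close>

definition proper_contraction :: "'a set \<Rightarrow> ('a \<Rightarrow> 'a \<Rightarrow> real) \<Rightarrow> ('a \<Rightarrow> 'a) \<Rightarrow> bool" where
  "proper_contraction X d g \<longleftrightarrow>
     g \<in> X \<rightarrow> X \<and>
     (\<exists>c. 0 \<le> c \<and> c < 1 \<and> (\<forall>x\<in>X. \<forall>y\<in>X. d (g x) (g y) \<le> c * d x y))"

locale hyperbolic_ifs = Metric_space X d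
  for X :: "'a set" and d :: "'a \<Rightarrow> 'a \<Rightarrow> real" +
  fixes I :: "'i set" and \<gamma> :: "'i \<Rightarrow> 'a \<Rightarrow> 'a"
  assumes space_nonempty: "X \<noteq> {}"
    and complete: "mcomplete"
    and finite_index: "finite I"
    and index_nonempty: "I \<noteq> {}"
    and contraction: "\<And>i. i \<in> I \<Longrightarrow> proper_contraction X d (\<gamma> i)"

definition nonempty_compacts :: "'a set \<Rightarrow> ('a \<Rightarrow> 'a \<Rightarrow> real) \<Rightarrow> 'a set set" where
  "nonempty_compacts X d = {K. K \<noteq> {} \<and> compactin (Metric_space.mtopology X d) K}"

definition hutchinson :: "'i set \<Rightarrow> ('i \<Rightarrow> 'a \<Rightarrow> 'a) \<Rightarrow> 'a set \<Rightarrow> 'a set" where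
  "hutchinson I \<gamma> K = (\<Union>i\<in>I. \<gamma> i ` K)"

definition is_attractor ::
  "'a set \<Rightarrow> ('a \<Rightarrow> 'a \<Rightarrow> real) \<Rightarrow> 'i set \<Rightarrow> ('i \<Rightarrow> 'a \<Rightarrow> 'a) \<Rightarrow> 'a set \<Rightarrow> bool" where
  "is_attractor X d I \<gamma> K \<longleftrightarrow>
     K \<in> nonempty_compacts X d \<and> hutchinson I \<gamma> K = K \<and>
     (\<forall>L\<in>nonempty_compacts X d. hutchinson I \<gamma> L = L \<longrightarrow> L = K)"

definition ifs_morphism ::
  "'a set \<Rightarrow> ('a \<Rightarrow> 'a \<Rightarrow> real) \<Rightarrow> 'i set \<Rightarrow> ('i \<Rightarrow> 'a \<Rightarrow> 'a) \<Rightarrow>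
   'b set \<Rightarrow> ('b \<Rightarrow> 'b \<Rightarrow> real) \<Rightarrow> 'j set \<Rightarrow> ('j \<Rightarrow> 'b \<Rightarrow> 'b) \<Rightarrow>
   ('a \<Rightarrow> 'b) \<Rightarrow> ('i \<Rightarrow> 'j) \<Rightarrow> bool" where
  "ifs_morphism X dX I \<gamma> Y dY J \<mu> f \<alpha> \<longleftrightarrow>
     continuous_map (Metric_space.mtopology X dX) (Metric_space.mtopology Y dY) f \<and>
     \<alpha> \<in> I \<rightarrow> J \<and>
     (\<forall>i\<in>I. \<forall>x\<in>X. f (\<gamma> i x) = \<mu> (\<alpha> i) (f x))"

definition max_dist ::
  "('a \<Rightarrow> 'a \<Rightarrow> real) \<Rightarrow> ('b \<Rightarrow> 'b \<Rightarrow> real) \<Rightarrow> 'a \<times> 'b \<Rightarrow> 'a \<times> 'b \<Rightarrow> real" where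
  "max_dist dX dY p q = max (dX (fst p) (fst q)) (dY (snd p) (snd q))"

text \<open>
  The maps \<open>\<gamma>\<^sup>\<alpha>\<close> of the fibred system, indexed by the index set of the first system.
\<close>

definition fibred ::
  "('i \<Rightarrow> 'a \<Rightarrow> 'a) \<Rightarrow> ('i \<Rightarrow> 'j) \<Rightarrow> ('j \<Rightarrow> 'b \<Rightarrow> 'b) \<Rightarrow> 'i \<Rightarrow> 'a \<times> 'b \<Rightarrow> 'a \<times> 'b" where
  "fibred \<gamma> \<alpha> \<mu> i = (\<lambda>(x, y). (\<gamma> i x, \<mu> (\<alpha> i) y))"

lemma proper_contraction_fibred:
  assumes "proper_contraction X dX g" "proper_contraction Y dY h"
    and "Metric_space X dX" "Metric_space Y dY"
  shows "proper_contraction (X \<times> Y) (max_dist dX dY) (\<lambda>(x, y). (g x, h y))"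
proof -
  obtain c where c: "0 \<le> c" "c < 1" "\<And>x y. x \<in> X \<Longrightarrow> y \<in> X \<Longrightarrow> dX (g x) (g y) \<le> c * dX x y"
    using assms(1) unfolding proper_contraction_def by blast
  obtain e where e: "0 \<le> e" "e < 1" "\<And>x y. x \<in> Y \<Longrightarrow> y \<in> Y \<Longrightarrow> dY (h x) (h y) \<le> e * dY x y"
    using assms(2) unfolding proper_contraction_def by blast
  have "max_dist dX dY (g x, h y) (g x', h y') \<le> max c e * max_dist dX dY (x, y) (x', y')"
    if "x \<in> X" "x' \<in> X" "y \<in> Y" "y' \<in> Y" for x y x' y'
  proof -
    have "c * dX x x' \<le> max c e * max (dX x x') (dY y y')"
      using c(1) assms(3) by (intro mult_mono) (auto simp: Metric_space.nonneg)
    moreover have "e * dY y y' \<le> max c e * max (dX x x') (dY y y')"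
      using e(1) assms(4) by (intro mult_mono) (auto simp: Metric_space.nonneg)
    ultimately show ?thesis
      using c(3)[OF that(1,2)] e(3)[OF that(3,4)] by (simp add: max_dist_def)
  qed
  moreover have "(\<lambda>(x, y). (g x, h y)) \<in> X \<times> Y \<rightarrow> X \<times> Y"
    using assms(1,2) by (auto simp: proper_contraction_def)
  ultimately show ?thesis
    unfolding proper_contraction_def using c e by (intro conjI exI[of _ "max c e"]) auto
qed

lemma Metric_space_max_dist:
  assumes "Metric_space X dX" "Metric_space Y dY"
  shows "Metric_space (X \<times> Y) (max_dist dX dY)"
proof -
  interpret X: Metric_space X dX by fact
  interpret Y: Metric_space Y dY by fact
  show ?thesis
  proof
    fix p q :: "'a \<times> 'b"
    show "0 \<le> max_dist dX dY p q" by (simp add: max_dist_def le_max_iff_disj)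
    show "max_dist dX dY p q = max_dist dX dY q p" by (simp add: max_dist_def X.commute Y.commute)
    assume "p \<in> X \<times> Y" "q \<in> X \<times> Y"
    moreover have "max a b = 0 \<longleftrightarrow> a = 0 \<and> b = 0" if "0 \<le> a" "0 \<le> b" for a b :: real
      using that by linarith
    ultimately show "max_dist dX dY p q = 0 \<longleftrightarrow> p = q"
      by (auto simp: max_dist_def)
  next
    fix p q r :: "'a \<times> 'b"
    assume "p \<in> X \<times> Y" "q \<in> X \<times> Y" "r \<in> X \<times> Y"
    then have "dX (fst p) (fst r) \<le> dX (fst p) (fst q) + dX (fst q) (fst r)"
      "dY (snd p) (snd r) \<le> dY (snd p) (snd q) + dY (snd q) (snd r)"
      by (auto intro: X.triangle Y.triangle)
    then show "max_dist dX dY p r \<le> max_dist dX dY p q + max_dist dX dY q r"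
      unfolding max_dist_def by linarith
  qed
qed

lemma mcomplete_max_dist:
  assumes "Metric_space X dX" "Metric_space Y dY"
    and "Metric_space.mcomplete X dX" "Metric_space.mcomplete Y dY"
  shows "Metric_space.mcomplete (X \<times> Y) (max_dist dX dY)"
proof -
  interpret X: Metric_space X dX by fact
  interpret Y: Metric_space Y dY by fact
  interpret P: Metric_space "X \<times> Y" "max_dist dX dY" by (rule Metric_space_max_dist) fact+
  show ?thesis
    unfolding P.mcomplete_def
  proof (intro allI impI)
    fix \<sigma> assume \<sigma>: "P.MCauchy \<sigma>"
    then have in_XY: "\<sigma> n \<in> X \<times> Y" for n by (auto simp: P.MCauchy_def)
    have "X.MCauchy (fst \<circ> \<sigma>)"
      using \<sigma> in_XY unfolding P.MCauchy_def X.MCauchy_def max_dist_def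
      by (auto simp: mem_Times_iff) meson
    then obtain x where x: "limitin X.mtopology (fst \<circ> \<sigma>) x sequentially"
      using assms(3) X.mcomplete_def by blast
    have "Y.MCauchy (snd \<circ> \<sigma>)"
      using \<sigma> in_XY unfolding P.MCauchy_def Y.MCauchy_def max_dist_def
      by (auto simp: mem_Times_iff) meson
    then obtain y where y: "limitin Y.mtopology (snd \<circ> \<sigma>) y sequentially"
      using assms(4) Y.mcomplete_def by blast
    have "\<forall>\<^sub>F n in sequentially. \<sigma> n \<in> X \<times> Y \<and> max_dist dX dY (\<sigma> n) (x, y) < \<epsilon>" if "\<epsilon> > 0" for \<epsilon>
    proof -
      have "\<forall>\<^sub>F n in sequentially. dX (fst (\<sigma> n)) x < \<epsilon>" "\<forall>\<^sub>F n in sequentially. dY (snd (\<sigma> n)) y < \<epsilon>"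
        using x y that by (auto simp: X.limitin_metric Y.limitin_metric elim!: eventually_mono)
      then show ?thesis
        by eventually_elim (use in_XY in \<open>auto simp: max_dist_def\<close>)
    qed
    then show "\<exists>z. limitin P.mtopology \<sigma> z sequentially"
      using x y by (intro exI[of _ "(x, y)"]) (auto simp: P.limitin_metric X.limitin_metric Y.limitin_metric)
  qed
qed

lemma hyperbolic_ifs_fibred:
  assumes "hyperbolic_ifs X dX I \<gamma>" "hyperbolic_ifs Y dY J \<mu>" "\<alpha> \<in> I \<rightarrow> J"
  shows "hyperbolic_ifs (X \<times> Y) (max_dist dX dY) I (fibred \<gamma> \<alpha> \<mu>)"
proof -
  interpret X: hyperbolic_ifs X dX I \<gamma> by fact
  interpret Y: hyperbolic_ifs Y dY J \<mu> by fact
  have M: "Metric_space X dX" "Metric_space Y dY" by unfold_locales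
  show ?thesis
  proof (intro hyperbolic_ifs.intro hyperbolic_ifs_axioms.intro)
    show "Metric_space (X \<times> Y) (max_dist dX dY)"
      using M by (rule Metric_space_max_dist)
    show "X \<times> Y \<noteq> {}" using X.space_nonempty Y.space_nonempty by auto
    show "Metric_space.mcomplete (X \<times> Y) (max_dist dX dY)"
      using M X.complete Y.complete by (rule mcomplete_max_dist)
    show "proper_contraction (X \<times> Y) (max_dist dX dY) (fibred \<gamma> \<alpha> \<mu> i)" if "i \<in> I" for i
      unfolding fibred_def
      using that assms(3) X.contraction Y.contraction M by (intro proper_contraction_fibred) auto
  qed (use X.finite_index X.index_nonempty in auto)
qed

end

theory Submission
  imports Defs
begin

text \<open>
  The fibred system acts on the graph of \<open>f\<close> by
  \<open>(x, f x) \<mapsto> (\<gamma> i x, \<mu> (\<alpha> i) (f x))\<close>. The image point lies again on the graph precisely when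
  \<open>f (\<gamma> i x) = \<mu> (\<alpha> i) (f x)\<close>, so the graph is mapped into itself by all maps of the fibred
  system iff \<open>f\<close> intertwines the two systems; since the maps \<open>\<gamma> i\<close> together cover \<open>A\<close>, the graph
  is then even a fixed point of the Hutchinson operator. On the topological side, \<open>A\<close> is compact,
  being its own attractor, and therefore \<open>f\<close> is continuous iff its graph is compact: a continuous
  \<open>f\<close> makes the graph the continuous image of \<open>A\<close>, and if the graph is compact, the projection
  onto \<open>A\<close> is a continuous bijection from a compact space to a Hausdorff space, whose inverse
  \<open>x \<mapsto> (x, f x)\<close> is therefore continuous. Together, \<open>(f, \<alpha>)\<close> is a morphism iff the graph is a
  nonempty compact fixed point of the Hutchinson operator, and the uniqueness half of Hutchinson's
  theorem makes any such fixed point the attractor.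
\<close>

text \<open>
  A point of \<open>K = \<Union>i. \<gamma> i ` K\<close> is \<open>\<gamma> i k\<close> for some \<open>k \<in> K\<close>, and a point of \<open>L\<close> near \<open>k\<close> is sent by
  the same \<open>\<gamma> i\<close> to a point of \<open>L\<close> nearer to \<open>\<gamma> i k\<close> by the factor \<open>c\<close>. Starting from a bound
  \<open>D\<close> on the distances between \<open>K\<close> and \<open>L\<close>, every point of \<open>K\<close> is thus within \<open>c ^ n * D\<close> of \<open>L\<close>
  for all \<open>n\<close>, hence in the closed set \<open>L\<close>.
\<close>

lemma (in hyperbolic_ifs) fixed_compact_subset:
  assumes K: "K \<in> nonempty_compacts X d" "hutchinson I \<gamma> K = K"
    and L: "L \<in> nonempty_compacts X d" "hutchinson I \<gamma> L = L"
  shows "K \<subseteq> L"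
proof
  fix x assume x: "x \<in> K"
  have compact: "compactin mtopology K" "compactin mtopology L"
    using K(1) L(1) by (auto simp: nonempty_compacts_def)
  have KX: "K \<subseteq> X" and LX: "L \<subseteq> X"
    using compact[THEN compactin_subset_topspace] by simp_all
  have "mbounded (K \<union> L)"
    using compact by (simp add: mbounded_Un compactin_imp_mbounded)
  then obtain D where D: "\<And>k l. k \<in> K \<Longrightarrow> l \<in> L \<Longrightarrow> d k l \<le> D"
    unfolding mbounded_alt by blast
  have "\<forall>i\<in>I. \<exists>c. 0 \<le> c \<and> c < 1 \<and> (\<forall>x\<in>X. \<forall>y\<in>X. d (\<gamma> i x) (\<gamma> i y) \<le> c * d x y)"
    using contraction by (auto simp: proper_contraction_def)
  then obtain r where r: "\<And>i. i \<in> I \<Longrightarrow> 0 \<le> r i" "\<And>i. i \<in> I \<Longrightarrow> r i < 1"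
    "\<And>i x y. i \<in> I \<Longrightarrow> x \<in> X \<Longrightarrow> y \<in> X \<Longrightarrow> d (\<gamma> i x) (\<gamma> i y) \<le> r i * d x y"
    by metis
  define c where "c = Max (r ` I)"
  have r_le: "r i \<le> c" if "i \<in> I" for i
    using that finite_index by (simp add: c_def)
  have c: "0 \<le> c" "c < 1"
  proof -
    show "c < 1" using r finite_index index_nonempty by (simp add: c_def)
    show "0 \<le> c" using r(1) r_le index_nonempty by fastforce
  qed
  have near: "\<exists>l\<in>L. d k l \<le> c ^ n * D" if "k \<in> K" for n k
    using that
  proof (induction n arbitrary: k)
    case 0
    then show ?case using D L(1) by (auto simp: nonempty_compacts_def)
  next
    case (Suc n)
    then have "k \<in> (\<Union>i\<in>I. \<gamma> i ` K)"
      using K(2) by (simp add: hutchinson_def)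
    then obtain i k' where i: "i \<in> I" "k' \<in> K" "k = \<gamma> i k'"
      by blast
    then obtain l where l: "l \<in> L" "d k' l \<le> c ^ n * D"
      using Suc.IH by blast
    have "d k (\<gamma> i l) \<le> r i * d k' l"
      using r(3) i l KX LX by blast
    also have "\<dots> \<le> c * (c ^ n * D)"
      using r_le i(1) c(1) l(2) by (intro mult_mono) auto
    finally have "d k (\<gamma> i l) \<le> c ^ Suc n * D"
      by (simp add: mult.assoc)
    moreover have "\<gamma> i l \<in> L"
      using L(2) i(1) l(1) unfolding hutchinson_def by blast
    ultimately show ?case by blast
  qed
  have "x \<in> mtopology closure_of L"
    unfolding metric_closure_of
  proof (intro CollectI conjI allI impI)
    show "x \<in> X" using x KX by blast
    fix e :: real assume "0 < e"
    have "(\<lambda>n. c ^ n * D) \<longlonglongrightarrow> 0"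
      using c by (intro tendsto_mult_left_zero LIMSEQ_power_zero) auto
    then have "\<forall>\<^sub>F n in sequentially. c ^ n * D < e"
      using \<open>0 < e\<close> by (rule order_tendstoD)
    then obtain n where "c ^ n * D < e"
      by (auto simp: eventually_sequentially)
    with near[OF x, of n] show "\<exists>y\<in>L. y \<in> mball x e"
      using x KX LX by fastforce
  qed
  moreover have "closedin mtopology L"
    using compact by (simp add: compactin_imp_closedin Hausdorff_space_mtopology)
  ultimately show "x \<in> L" by (simp add: closure_of_closedin)
qed

lemma (in hyperbolic_ifs) is_attractor_iff_fixed_compact:
  "is_attractor X d I \<gamma> K \<longleftrightarrow> K \<in> nonempty_compacts X d \<and> hutchinson I \<gamma> K = K"
  unfolding is_attractor_def using fixed_compact_subset by blast

text \<open>
  If the graph is compact, the projection \<open>fst\<close> from it onto \<open>X\<close> is a homeomorphism, as a continuous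
  bijection from a compact space to a Hausdorff space, and \<open>f\<close> is its inverse followed by \<open>snd\<close>.
  Compactness of \<open>X\<close> enters in the other direction, where the graph is the image of \<open>X\<close> under the
  continuous map \<open>x \<mapsto> (x, f x)\<close>.
\<close>

lemma continuous_map_iff_compact_graph:
  fixes f :: "'a \<Rightarrow> 'b"
  assumes X: "Metric_space X dX" and Y: "Metric_space Y dY"
    and compact: "compactin (Metric_space.mtopology X dX) X" and f: "f \<in> X \<rightarrow> Y"
  shows "continuous_map (Metric_space.mtopology X dX) (Metric_space.mtopology Y dY) f \<longleftrightarrow>
    compactin (Metric_space.mtopology (X \<times> Y) (max_dist dX dY)) {(x, f x) | x. x \<in> X}"
    (is "?cont \<longleftrightarrow> compactin _ ?G")
proof -
  interpret X: Metric_space X dX by fact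
  interpret Y: Metric_space Y dY by fact
  interpret P: Metric_space "X \<times> Y" "max_dist dX dY" by (rule Metric_space_max_dist) fact+
  have G: "?G \<subseteq> X \<times> Y" using f by auto
  have G_image: "?G = (\<lambda>x. (x, f x)) ` X" by auto
  show ?thesis
  proof
    assume cont: ?cont
    have "continuous_map X.mtopology P.mtopology (\<lambda>x. (x, f x))"
      unfolding X.metric_continuous_map[OF P.Metric_space_axioms]
    proof (intro conjI ballI allI impI)
      fix a and e :: real assume a: "a \<in> X" "0 < e"
      have "\<forall>a\<in>X. \<forall>e>0. \<exists>\<delta>>0. \<forall>x. x \<in> X \<and> dX a x < \<delta> \<longrightarrow> dY (f a) (f x) < e"
        using cont[unfolded X.metric_continuous_map[OF Y]] by (rule conjunct2)
      with a obtain \<delta> where \<delta>: "0 < \<delta>"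
        "\<And>x. x \<in> X \<Longrightarrow> dX a x < \<delta> \<Longrightarrow> dY (f a) (f x) < e"
        by meson
      \<comment> \<open>The first coordinate also has to move by less than \<open>e\<close>.\<close>
      show "\<exists>\<delta>>0. \<forall>x. x \<in> X \<and> dX a x < \<delta> \<longrightarrow> max_dist dX dY (a, f a) (x, f x) < e"
        using \<delta> a by (intro exI[of _ "min \<delta> e"]) (auto simp: max_dist_def)
    qed (use f in auto)
    with compact show "compactin P.mtopology ?G"
      unfolding G_image by (rule image_compactin)
  next
    assume G_compact: "compactin P.mtopology ?G"
    define GT where "GT = subtopology P.mtopology ?G"
    have GT: "topspace GT = ?G" using G by (auto simp: GT_def)
    have "continuous_map P.mtopology X.mtopology fst"
      unfolding P.metric_continuous_map[OF X]
      by (intro conjI ballI allI impI exI) (auto simp: max_dist_def)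
    then have "continuous_map GT X.mtopology fst"
      unfolding GT_def by (rule continuous_map_from_subtopology)
    then have "homeomorphic_map GT X.mtopology fst"
    proof (rule continuous_imp_homeomorphic_map)
      show "compact_space GT"
        using G_compact by (simp add: GT_def compact_space_subtopology)
      show "fst ` topspace GT = topspace X.mtopology"
        unfolding GT by force
    qed (auto simp: GT X.Hausdorff_space_mtopology inj_on_def)
    then obtain h where h: "homeomorphic_maps GT X.mtopology fst h"
      by (auto simp: homeomorphic_map_maps)
    have h_eq: "h x = (x, f x)" if "x \<in> X" for x
    proof -
      have "h (fst (x, f x)) = (x, f x)"
        using h that GT unfolding homeomorphic_maps_def by blast
      then show ?thesis by simp
    qed
    have "continuous_map P.mtopology Y.mtopology snd"
      unfolding P.metric_continuous_map[OF Y]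
      by (intro conjI ballI allI impI exI) (auto simp: max_dist_def)
    then have "continuous_map GT Y.mtopology snd"
      unfolding GT_def by (rule continuous_map_from_subtopology)
    moreover have "continuous_map X.mtopology GT h"
      using h by (simp add: homeomorphic_maps_def)
    ultimately have "continuous_map X.mtopology Y.mtopology (snd \<circ> h)"
      by (rule continuous_map_compose[rotated])
    then show ?cont
      by (rule continuous_map_eq) (simp add: h_eq)
  qed
qed

text \<open>
  A graph contains only one point over each \<open>\<gamma> i x\<close>, which gives the equation for \<open>f\<close>. Conversely,
  the equation places the image of the graph inside the graph, and it fills the graph because every
  point of \<open>A\<close> is some \<open>\<gamma> i x\<close>.
\<close>

lemma graph_hutchinson_fixed_iff:
  assumes fixed: "hutchinson I \<gamma> A = A"
  shows "hutchinson I (fibred \<gamma> \<alpha> \<mu>) {(x, f x) | x. x \<in> A} = {(x, f x) | x. x \<in> A} \<longleftrightarrow>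
    (\<forall>i\<in>I. \<forall>x\<in>A. f (\<gamma> i x) = \<mu> (\<alpha> i) (f x))"
    (is "hutchinson I ?\<phi> ?G = ?G \<longleftrightarrow> ?eq")
proof
  assume G: "hutchinson I ?\<phi> ?G = ?G"
  show ?eq
  proof (intro ballI)
    fix i x assume "i \<in> I" "x \<in> A"
    then have "?\<phi> i (x, f x) \<in> hutchinson I ?\<phi> ?G"
      unfolding hutchinson_def by blast
    then have "(\<gamma> i x, \<mu> (\<alpha> i) (f x)) \<in> ?G"
      unfolding G by (simp add: fibred_def)
    then show "f (\<gamma> i x) = \<mu> (\<alpha> i) (f x)" by simp
  qed
next
  assume eq: ?eq
  have "?\<phi> i ` ?G = (\<lambda>x. (x, f x)) ` \<gamma> i ` A" if "i \<in> I" for i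
    using eq that by (force simp: fibred_def image_iff)
  then have "hutchinson I ?\<phi> ?G = (\<lambda>x. (x, f x)) ` hutchinson I \<gamma> A"
    by (simp add: hutchinson_def image_UN)
  also have "\<dots> = ?G" unfolding fixed by auto
  finally show "hutchinson I ?\<phi> ?G = ?G" .
qed

theorem corollary4p3:
  fixes A :: "'a set" and dA :: "'a \<Rightarrow> 'a \<Rightarrow> real" and I :: "'i set" and \<gamma> :: "'i \<Rightarrow> 'a \<Rightarrow> 'a"
    and B :: "'b set" and dB :: "'b \<Rightarrow> 'b \<Rightarrow> real" and J :: "'j set" and \<mu> :: "'j \<Rightarrow> 'b \<Rightarrow> 'b"
    and f :: "'a \<Rightarrow> 'b" and \<alpha> :: "'i \<Rightarrow> 'j"
  assumes "hyperbolic_ifs A dA I \<gamma>" and "is_attractor A dA I \<gamma> A"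
    and "hyperbolic_ifs B dB J \<mu>" and "is_attractor B dB J \<mu> B"
    and "f \<in> A \<rightarrow> B" and "\<alpha> \<in> I \<rightarrow> J"
  shows "ifs_morphism A dA I \<gamma> B dB J \<mu> f \<alpha> \<longleftrightarrow>
         is_attractor (A \<times> B) (max_dist dA dB) I (fibred \<gamma> \<alpha> \<mu>) {(x, f x) | x. x \<in> A}"
proof -
  interpret A: hyperbolic_ifs A dA I \<gamma> by fact
  interpret B: hyperbolic_ifs B dB J \<mu> by fact
  interpret P: hyperbolic_ifs "A \<times> B" "max_dist dA dB" I "fibred \<gamma> \<alpha> \<mu>"
    using assms(1,3,6) by (rule hyperbolic_ifs_fibred)
  have A_compact: "compactin A.mtopology A" and A_fixed: "hutchinson I \<gamma> A = A"
    using assms(2) by (auto simp: is_attractor_def nonempty_compacts_def)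
  have "{(x, f x) | x. x \<in> A} \<noteq> {}"
    using A.space_nonempty by auto
  then show ?thesis
    unfolding ifs_morphism_def P.is_attractor_iff_fixed_compact
      graph_hutchinson_fixed_iff[OF A_fixed] nonempty_compacts_def
      continuous_map_iff_compact_graph
        [OF A.Metric_space_axioms B.Metric_space_axioms A_compact assms(5)]
    using assms(6) by blast
qed

end
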